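(* Let $\{a_n\}_{n=1}^{\infty}$ be a real sequence with $\lim_{n\to\infty} a_n = \frac14$. If $\{a_n\}$ is a chain sequence with a parameter sequence $\{g_n\}_{n=0}^{\infty}$, then $\lim_{n\to\infty} g_n$ exists and $\lim_{n\to\infty} g_n = \frac12$.
   Context: A sequence $\{a_n\}_{n=1}^{\infty}$ is called a chain sequence if there is a sequence $\{g_n\}_{n=0}^{\infty}$ with $0\le g_n\le 1$ for all $n\ge 0$ such that $a_n = g_n(1-g_{n-1})$ for all $n\ge 1$. Any such $\{g_n\}_{n=0}^{\infty}$ is called a parameter sequence of $\{a_n\}$. *)

theory Defs
  imports Complex_Main
begin

text \<open>
  The sequence \<open>a\<close> is indexed from 1; its value \<open>a 0\<close> is never constrained.
  The sequence \<open>g\<close> is indexed from 0.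
\<close>

definition parameter_sequence :: "(nat \<Rightarrow> real) \<Rightarrow> (nat \<Rightarrow> real) \<Rightarrow> bool" where
  "parameter_sequence a g \<longleftrightarrow>
     (\<forall>n. 0 \<le> g n \<and> g n \<le> 1) \<and> (\<forall>n\<ge>1. a n = g n * (1 - g (n - 1)))"

definition chain_sequence :: "(nat \<Rightarrow> real) \<Rightarrow> bool" where
  "chain_sequence a \<longleftrightarrow> (\<exists>g. parameter_sequence a g)"

end

theory Submission
  imports Defs
begin

text \<open>
  With \<open>x = g n\<close>, \<open>y = g (n + 1)\<close> and \<open>\<alpha> = a (n + 1)\<close> the relation \<open>\<alpha> = y (1 - x)\<close> reads
  \[ (1 - x)(y - x) = (x - 1/2)^2 + (\<alpha> - 1/4). \]
  Fix \<open>\<epsilon> > 0\<close> and consider only indices so large that \<open>\<alpha>\<close> is within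
  \<open>\<epsilon>\<^sup>2 / 2\<close> of \<open>1/4\<close>.  Then, as long as \<open>x\<close> stays at
  distance at least \<open>\<epsilon>\<close> from \<open>1/2\<close>, each step moves the sequence upwards by at least
  \<open>\<epsilon>\<^sup>2 / 2\<close> (\<open>parameter_increment\<close>).  A sequence bounded above cannot do this forever
  (\<open>bounded_above_not_forever_increasing_by\<close>).  Hence it never reaches
  \<open>1/2 + \<epsilon>\<close>, since from there it could only climb, without bound; and it must
  climb out of the region below \<open>1/2 - \<epsilon>\<close>, to which it cannot return
  (\<open>parameter_stays_above\<close>).
\<close>

lemma bounded_above_not_forever_increasing_by:
  fixes f :: "nat \<Rightarrow> real"
  assumes bound: "\<And>n. f n \<le> B" and "\<delta> > 0"
    and step: "\<And>n. n \<ge> N \<Longrightarrow> f n + \<delta> \<le> f (Suc n)"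
  shows False
proof -
  have growth: "f N + real k * \<delta> \<le> f (N + k)" for k
  proof (induction k)
    case (Suc k)
    then show ?case using step[of "N + k"] by (simp add: algebra_simps)
  qed simp
  obtain k where "B - f N < real k * \<delta>"
    using reals_Archimedean3[OF \<open>\<delta> > 0\<close>] by blast
  with growth[of k] bound[of "N + k"] show False by linarith
qed

text \<open>
  In the identity \<open>(1 - x)(y - x) = (x - 1/2)\<^sup>2 + (y (1 - x) - 1/4)\<close> the right-hand side is
  at least \<open>\<epsilon>\<^sup>2 - \<epsilon>\<^sup>2 / 2\<close>.  It is thus positive, so \<open>y - x\<close> is nonnegative, and then
  the left-hand side is at most \<open>y - x\<close>, because \<open>0 \<le> 1 - x \<le> 1\<close>.
\<close>

lemma parameter_increment:
  fixes x y \<epsilon> :: real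
  assumes "0 \<le> x" "x \<le> 1" "\<epsilon> > 0" "\<epsilon> \<le> \<bar>x - 1/2\<bar>"
    and "1/4 - \<epsilon>\<^sup>2 / 2 \<le> y * (1 - x)"
  shows "x + \<epsilon>\<^sup>2 / 2 \<le> y"
proof -
  have "\<epsilon>\<^sup>2 \<le> (x - 1/2)\<^sup>2"
    using assms power_mono[of \<epsilon> "\<bar>x - 1/2\<bar>" 2] by simp
  moreover have "(1 - x) * (y - x) = (x - 1/2)\<^sup>2 + (y * (1 - x) - 1/4)"
    by (simp add: power2_eq_square algebra_simps)
  ultimately have lower: "\<epsilon>\<^sup>2 / 2 \<le> (1 - x) * (y - x)"
    using assms by linarith
  moreover have "\<epsilon>\<^sup>2 / 2 > 0" using assms by simp
  ultimately have "0 < (1 - x) * (y - x)" by linarith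
  then have "0 \<le> y - x"
    using assms by (simp add: zero_less_mult_iff)
  then have "(1 - x) * (y - x) \<le> y - x"
    using assms by (intro mult_left_le_one_le) auto
  with lower show ?thesis by linarith
qed

text \<open>
  If \<open>y\<close> were at most \<open>1/2 - \<epsilon>\<close>, the product would be at most
  \<open>(1/2 - \<epsilon>)(1/2 + \<epsilon>) = 1/4 - \<epsilon>\<^sup>2\<close>, below its assumed lower bound.
\<close>

lemma parameter_stays_above:
  fixes x y \<epsilon> :: real
  assumes "x \<le> 1" "0 \<le> y" "\<epsilon> > 0" "1/2 - \<epsilon> < x"
    and "1/4 - \<epsilon>\<^sup>2 / 2 \<le> y * (1 - x)"
  shows "1/2 - \<epsilon> < y"
proof (rule ccontr)
  assume "\<not> 1/2 - \<epsilon> < y"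
  then have "y * (1 - x) \<le> (1/2 - \<epsilon>) * (1/2 + \<epsilon>)"
    using assms by (intro mult_mono) auto
  also have "\<dots> = 1/4 - \<epsilon>\<^sup>2"
    by (simp add: power2_eq_square algebra_simps)
  also have "\<dots> < 1/4 - \<epsilon>\<^sup>2 / 2"
    using \<open>\<epsilon> > 0\<close> by simp
  finally show False using assms by linarith
qed

theorem proposition2p1:
  fixes a g :: "nat \<Rightarrow> real"
  assumes "a \<longlonglongrightarrow> 1 / 4"
    and "chain_sequence a"
    and "parameter_sequence a g"
  shows "g \<longlonglongrightarrow> 1 / 2"
proof (rule LIMSEQ_I)
  fix \<epsilon> :: real
  assume "0 < \<epsilon>"
  have range: "0 \<le> g n" "g n \<le> 1" for n
    using assms(3) by (auto simp: parameter_sequence_def)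
  have rec: "a (Suc n) = g (Suc n) * (1 - g n)" for n
    using assms(3) by (simp add: parameter_sequence_def)
  have \<delta>: "\<epsilon>\<^sup>2 / 2 > 0" using \<open>0 < \<epsilon>\<close> by simp
  obtain N where N: "\<And>n. n \<ge> N \<Longrightarrow> \<bar>a n - 1/4\<bar> < \<epsilon>\<^sup>2 / 2"
    using LIMSEQ_D[OF assms(1) \<delta>] by auto
  have near: "1/4 - \<epsilon>\<^sup>2 / 2 \<le> g (Suc n) * (1 - g n)" if "n \<ge> N" for n
    using N[of "Suc n"] that unfolding rec by linarith
  have climb: "g n + \<epsilon>\<^sup>2 / 2 \<le> g (Suc n)" if "n \<ge> N" "\<epsilon> \<le> \<bar>g n - 1/2\<bar>" for n
    using parameter_increment[OF range \<open>0 < \<epsilon>\<close> that(2) near[OF that(1)]] .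
  have above: "g n < 1/2 + \<epsilon>" if "n \<ge> N" for n
  proof (rule ccontr)
    assume high: "\<not> g n < 1/2 + \<epsilon>"
    have stays: "1/2 + \<epsilon> \<le> g m" if "m \<ge> n" for m
      using that
    proof (induction m rule: dec_induct)
      case base
      then show ?case using high by simp
    next
      case (step m)
      then show ?case using climb[of m] \<open>n \<ge> N\<close> \<delta> by linarith
    qed
    have "g m + \<epsilon>\<^sup>2 / 2 \<le> g (Suc m)" if "m \<ge> n" for m
      using climb[of m] stays[OF that] that \<open>n \<ge> N\<close> by linarith
    then show False
      using bounded_above_not_forever_increasing_by[where f = g, OF range(2) \<delta>] by blast
  qed
  have "\<exists>M\<ge>N. 1/2 - \<epsilon> < g M"
  proof (rule ccontr)
    assume "\<not> (\<exists>M\<ge>N. 1/2 - \<epsilon> < g M)"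
    then have low: "g n \<le> 1/2 - \<epsilon>" if "n \<ge> N" for n
      using that by (simp add: not_less)
    have "g n + \<epsilon>\<^sup>2 / 2 \<le> g (Suc n)" if "n \<ge> N" for n
      using climb[of n] low[OF that] that by linarith
    then show False
      using bounded_above_not_forever_increasing_by[where f = g, OF range(2) \<delta>] by blast
  qed
  then obtain M where M: "M \<ge> N" "1/2 - \<epsilon> < g M" by blast
  have below: "1/2 - \<epsilon> < g n" if "n \<ge> M" for n
    using that
  proof (induction n rule: dec_induct)
    case base
    show ?case by (fact M(2))
  next
    case (step n)
    then show ?case
      using parameter_stays_above[OF range(2) range(1) \<open>0 < \<epsilon>\<close>] near[of n] M(1) by simp
  qed
  have "norm (g n - 1/2) < \<epsilon>" if "n \<ge> M" for n
    using above[of n] below[OF that] that M(1) by (simp add: abs_less_iff)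
  then show "\<exists>M. \<forall>n\<ge>M. norm (g n - 1/2) < \<epsilon>" by blast
qed

end
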